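(* Let $\alpha\in(0,1)\setminus\mathbb{Q}$ with partial quotients $a_1,a_2,\dots$. The set $\mathcal{V}_\alpha$ has Lebesgue measure zero if and only if $$\sum_{n=1}^\infty\frac{1}{a_n}=+\infty.$$
   Context: Let $\alpha\in(0,1)\setminus\mathbb{Q}$ have the regular continued fraction expansion $\alpha=\cfrac{1}{a_1+\cfrac{1}{a_2+\cdots}}$ with partial quotients $a_n\in\mathbb{N}$, $n\ge1$. Define $p_1=0$, $p_2=1$, $q_1=1$, $q_2=a_1$, and $p_{n+1}=a_np_n+p_{n-1}$, $q_{n+1}=a_nq_n+q_{n-1}$ for $n\ge2$. Put $\alpha_n=|q_n\alpha-p_n|$ for $n\ge1$. Let $Z_\alpha=\prod_{n=1}^\infty\{0,1,\dots,a_n\}$, and let $\mathcal{V}_\alpha$ be the set of all $x\in(0,1)$ for which there exists exactly one sequence $(x_1,x_2,\dots)\in Z_\alpha$ with $x=\sum_{n=1}^\infty x_n\alpha_n$. *)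

theory Defs
  imports "HOL-Analysis.Analysis"
begin

(* Sequences are indexed from 1 as in the mathematics; values at index 0 are irrelevant throughout. *)

text \<open>\<open>cf_frac a k n\<close> is the finite continued fraction
  \<open>1 / (a k + 1 / (a (k+1) + \<dots> + 1 / a (k+n-1)))\<close> with \<open>n\<close> levels.\<close>

fun cf_frac :: "(nat \<Rightarrow> nat) \<Rightarrow> nat \<Rightarrow> nat \<Rightarrow> real" where
  "cf_frac a k 0 = 0"
| "cf_frac a k (Suc n) = 1 / (real (a k) + cf_frac a (Suc k) n)"

definition regular_cf_expansion :: "real \<Rightarrow> (nat \<Rightarrow> nat) \<Rightarrow> bool" where
  "regular_cf_expansion \<alpha> a \<longleftrightarrow> (\<forall>n\<ge>1. a n \<ge> 1) \<and> cf_frac a 1 \<longlonglongrightarrow> \<alpha>"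

fun cf_num :: "(nat \<Rightarrow> nat) \<Rightarrow> nat \<Rightarrow> nat" where
  "cf_num a 0 = 0"
| "cf_num a (Suc 0) = 0"
| "cf_num a (Suc (Suc 0)) = 1"
| "cf_num a (Suc (Suc (Suc n))) = a (Suc (Suc n)) * cf_num a (Suc (Suc n)) + cf_num a (Suc n)"

fun cf_den :: "(nat \<Rightarrow> nat) \<Rightarrow> nat \<Rightarrow> nat" where
  "cf_den a 0 = 0"
| "cf_den a (Suc 0) = 1"
| "cf_den a (Suc (Suc 0)) = a 1"
| "cf_den a (Suc (Suc (Suc n))) = a (Suc (Suc n)) * cf_den a (Suc (Suc n)) + cf_den a (Suc n)"

definition cf_dist :: "real \<Rightarrow> (nat \<Rightarrow> nat) \<Rightarrow> nat \<Rightarrow> real" where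
  "cf_dist \<alpha> a n = \<bar>real (cf_den a n) * \<alpha> - real (cf_num a n)\<bar>"

text \<open>The product is extensional, so that the irrelevant value at index 0 does not interfere with
  the uniqueness of digit sequences.\<close>

definition digit_seqs :: "(nat \<Rightarrow> nat) \<Rightarrow> (nat \<Rightarrow> nat) set" where
  "digit_seqs a = (\<Pi>\<^sub>E n\<in>{1..}. {0..a n})"

definition unique_expansion_set :: "real \<Rightarrow> (nat \<Rightarrow> nat) \<Rightarrow> real set" where
  "unique_expansion_set \<alpha> a = {t \<in> {0<..<1}.
     \<exists>!x. x \<in> digit_seqs a \<and> (\<lambda>n. real (x (Suc n)) * cf_dist \<alpha> a (Suc n)) sums t}"

end

theory Submission
  imports Defs
begin

text \<open>
  Put \<open>\<beta> 0 = 1\<close> and \<open>\<beta> n = \<alpha>\<^sub>n\<close>. The remainders are positive and satisfy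
  \<open>\<beta> n = a (n+1) * \<beta> (n+1) + \<beta> (n+2)\<close>.
  Summing this recurrence shows that the expansions whose first weight is \<open>\<beta> (n+1)\<close> (expansions of level \<open>n\<close>)
  have values in \<open>[0, \<beta> n + \<beta> (n+1)]\<close>, and a greedy choice of digits reaches every point of that
  interval. Choosing the first digit \<open>j\<close> thus means choosing one of \<open>a (n+1) + 1\<close> intervals
  \<open>j \<beta> (n+1) + [0, \<beta> (n+1) + \<beta> (n+2)]\<close>; neighbours overlap in an interval of length
  \<open>\<beta> (n+2)\<close>, and a point has a unique expansion iff neither it nor any of its successive
  remainders ever lies in an overlap.

  Consider the middle gap \<open>(\<beta> (n+1), \<beta> n)\<close> at level \<open>n\<close>. A uniquely expandable point there must
  have a first digit in \<open>{1..<a (n+1)}\<close>, and its remainder is uniquely expandable and lies in the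
  middle gap at level \<open>n + 1\<close>. So the uniquely expandable points of the gap form a Cantor-like set,
  the core of level \<open>n\<close>. It is the intersection of the sets \<open>middle_cover n m\<close>, and the \<open>m\<close>-th of these consists of
  \<open>\<Prod>k<m. (a (n+k+1) - 1)\<close> translates of an interval of length \<open>\<beta> (n+m) - \<beta> (n+m+1)\<close>.
  Since \<open>a (k+1) \<beta> (k+1) \<le> \<beta> k \<le> (a (k+1) + 1) \<beta> (k+1)\<close>, the measure of the core is at most
  \<open>\<beta> n * (\<Prod>k>n. 1 - 1 / a k)\<close>, and at least a constant times \<open>\<beta> n * (\<Prod>k>n. 1 - 2 / a k)\<close> where the
  partial quotients are large. The core is therefore null if \<open>\<Sum>k. 1 / a k\<close> diverges, and has
  positive measure for large \<open>n\<close> if the series converges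
  (\<open>measure_middle_cover_le\<close>, \<open>measure_middle_cover_ge\<close>).

  The middle gaps of all levels cover \<open>(0, 1)\<close> up to the countably many points \<open>\<beta> n\<close>, and for
  \<open>t < \<beta> n\<close> all digits before level \<open>n\<close> vanish, so that unique expansion at level \<open>n\<close> and at
  level \<open>0\<close> mean the same (\<open>uniquely_expands_iff_0\<close>). Hence the whole set is null iff all the
  cores are.
\<close>

section \<open>Remainders of a continued fraction\<close>

lemma cf_frac_bounds:
  assumes "\<And>n. n \<ge> 1 \<Longrightarrow> a n \<ge> 1" and "k \<ge> 1"
  shows "0 \<le> cf_frac a k n \<and> cf_frac a k n \<le> 1"
  using assms(2)
proof (induction n arbitrary: k)
  case (Suc n)
  have "0 \<le> cf_frac a (Suc k) n" "real (a k) \<ge> 1"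
    using Suc.IH[of "Suc k"] assms(1)[of k] Suc.prems by auto
  then show ?case by (simp add: divide_simps)
qed auto

text \<open>
  Here \<open>\<tau> n\<close> is the value of the tail of the continued fraction that starts with \<open>a n\<close>. Convergence
  passes from one tail to the next because its limit is irrational, hence not zero.
\<close>

lemma complete_quotients_exist:
  assumes "\<alpha> \<notin> \<rat>" and "regular_cf_expansion \<alpha> a"
  shows "\<exists>\<tau>. \<tau> 1 = \<alpha> \<and> (\<forall>n\<ge>1. 0 < \<tau> n \<and> \<tau> (Suc n) = 1 / \<tau> n - real (a n))"
proof -
  have a: "\<And>n. n \<ge> 1 \<Longrightarrow> a n \<ge> 1" and lim: "cf_frac a 1 \<longlonglongrightarrow> \<alpha>"
    using assms(2) by (auto simp: regular_cf_expansion_def)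
  define \<tau> where "\<tau> n = lim (cf_frac a n)" for n
  have step: "1 / c - real (a k) \<notin> \<rat> \<and> cf_frac a (Suc k) \<longlonglongrightarrow> 1 / c - real (a k)"
    if irr: "c \<notin> \<rat>" and c: "cf_frac a k \<longlonglongrightarrow> c" for c k
  proof
    show "1 / c - real (a k) \<notin> \<rat>"
    proof
      assume "1 / c - real (a k) \<in> \<rat>"
      then have "1 / ((1 / c - real (a k)) + real (a k)) \<in> \<rat>"
        by (intro Rats_divide Rats_add) auto
      then show False using irr by simp
    qed
    have "c \<noteq> 0" using irr by auto
    then have "(\<lambda>m. 1 / cf_frac a k (Suc m) - real (a k)) \<longlonglongrightarrow> 1 / c - real (a k)"
      using c by (intro tendsto_intros LIMSEQ_Suc)
    then show "cf_frac a (Suc k) \<longlonglongrightarrow> 1 / c - real (a k)" by simp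
  qed
  have conv: "\<tau> (Suc n) \<notin> \<rat> \<and> cf_frac a (Suc n) \<longlonglongrightarrow> \<tau> (Suc n)" for n
  proof (induction n)
    case 0
    then show ?case using lim assms(1) limI[OF lim] by (simp add: \<tau>_def)
  next
    case (Suc n)
    then have "1 / \<tau> (Suc n) - real (a (Suc n)) \<notin> \<rat> \<and>
        cf_frac a (Suc (Suc n)) \<longlonglongrightarrow> 1 / \<tau> (Suc n) - real (a (Suc n))"
      by (intro step) auto
    then show ?case using limI unfolding \<tau>_def by metis
  qed
  have pos: "0 < \<tau> n" if "n \<ge> 1" for n
  proof -
    obtain m where n: "n = Suc m" using \<open>n \<ge> 1\<close> by (cases n) auto
    have "0 \<le> \<tau> n"
      using conv[of m] cf_frac_bounds[OF a \<open>n \<ge> 1\<close>] unfolding n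
      by (intro LIMSEQ_le_const[of "cf_frac a (Suc m)"]) auto
    moreover have "\<tau> n \<noteq> 0" using conv[of m] n by auto
    ultimately show ?thesis by simp
  qed
  have rec: "\<tau> (Suc n) = 1 / \<tau> n - real (a n)" if "n \<ge> 1" for n
  proof -
    obtain m where n: "n = Suc m" using \<open>n \<ge> 1\<close> by (cases n) auto
    have "cf_frac a (Suc n) \<longlonglongrightarrow> 1 / \<tau> n - real (a n)"
      using step conv[of m] n by blast
    then show ?thesis unfolding \<tau>_def by (rule limI)
  qed
  have "\<tau> 1 = \<alpha>" unfolding \<tau>_def using lim by (rule limI)
  with pos rec show ?thesis by blast
qed

text \<open>
  The signed differences \<open>q\<^sub>n \<alpha> - p\<^sub>n\<close> satisfy the recurrence of the convergents, and so does the
  product of the first \<open>n\<close> tails with alternating sign.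
\<close>

lemma cf_dist_as_product:
  assumes "\<tau> 1 = \<alpha>" and pos: "\<And>n. n \<ge> 1 \<Longrightarrow> 0 < \<tau> n"
    and rec: "\<And>n. n \<ge> 1 \<Longrightarrow> \<tau> (Suc n) = 1 / \<tau> n - real (a n)"
  shows "cf_dist \<alpha> a (Suc n) = (\<Prod>k=1..Suc n. \<tau> k)"
proof -
  define D where "D n = real (cf_den a n) * \<alpha> - real (cf_num a n)" for n
  define P where "P n = (\<Prod>k=1..n. \<tau> k)" for n
  have PS: "P (Suc n) = P n * \<tau> (Suc n)" for n by (simp add: P_def)
  have "D (Suc n) = (-1) ^ n * P (Suc n) \<and> D (Suc (Suc n)) = (-1) ^ Suc n * P (Suc (Suc n))"
  proof (induction n)
    case 0
    have "\<tau> (Suc 1) = 1 / \<alpha> - real (a 1)" "\<alpha> > 0" using rec[of 1] assms(1) pos[of 1] by auto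
    then show ?case using assms(1) by (simp add: D_def P_def field_simps)
  next
    case (Suc n)
    let ?k = "Suc (Suc n)"
    have "D (Suc ?k) = real (a ?k) * D ?k + D (Suc n)" by (simp add: D_def algebra_simps)
    also have "\<dots> = (-1) ^ n * (P (Suc n) - real (a ?k) * P ?k)"
      using Suc.IH by (simp add: algebra_simps)
    also have "P (Suc n) - real (a ?k) * P ?k = P (Suc ?k)"
    proof -
      have "1 = \<tau> ?k * (real (a ?k) + \<tau> (Suc ?k))"
        using rec[of ?k] pos[of ?k] by (simp add: field_simps)
      then have "P (Suc n) = P (Suc n) * (\<tau> ?k * (real (a ?k) + \<tau> (Suc ?k)))" by simp
      then show ?thesis by (simp add: PS[of ?k] PS[of "Suc n"] algebra_simps)
    qed
    finally show ?case using Suc.IH by simp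
  qed
  moreover have "P (Suc n) > 0" unfolding P_def using pos by (intro prod_pos) auto
  ultimately have "\<bar>D (Suc n)\<bar> = P (Suc n)" by (simp add: abs_mult power_abs)
  then show ?thesis unfolding cf_dist_def D_def P_def .
qed

section \<open>Expansions at a given level\<close>

lemma nonneg_partial_sums_at_top:
  fixes f :: "nat \<Rightarrow> real"
  assumes "\<And>k. 0 \<le> f k" and "\<not> summable f"
  shows "filterlim (\<lambda>N. \<Sum>k<N. f k) at_top sequentially"
  unfolding filterlim_at_top
proof
  fix B
  obtain N where N: "B < (\<Sum>k\<le>N. f k)"
    using bounded_imp_summable[of f B] assms by (meson not_le)
  have "B \<le> (\<Sum>k<M. f k)" if "M \<ge> Suc N" for M
  proof -
    have "(\<Sum>k\<le>N. f k) \<le> (\<Sum>k<M. f k)" using that assms(1) by (intro sum_mono2) auto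
    then show ?thesis using N by linarith
  qed
  then show "\<forall>\<^sub>F M in sequentially. B \<le> (\<Sum>k<M. f k)" by (auto simp: eventually_sequentially)
qed

locale cf_remainders =
  fixes a :: "nat \<Rightarrow> nat" and \<beta> :: "nat \<Rightarrow> real"
  assumes quotient_ge_1: "a (Suc n) \<ge> 1"
    and rem_pos: "\<beta> n > 0"
    and rem_rec: "\<beta> n = real (a (Suc n)) * \<beta> (Suc n) + \<beta> (Suc (Suc n))"
begin

lemma quotient_mult_ge: "\<beta> (Suc n) \<le> real (a (Suc n)) * \<beta> (Suc n)"
  using quotient_ge_1[of n] rem_pos[of "Suc n"] by simp

lemma rem_Suc_less: "\<beta> (Suc n) < \<beta> n"
  using quotient_mult_ge[of n] rem_rec[of n] rem_pos[of "Suc (Suc n)"] by linarith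

lemma rem_antimono: "m \<le> n \<Longrightarrow> \<beta> n \<le> \<beta> m"
  using rem_Suc_less by (metis decseqD decseq_SucI less_imp_le)

text \<open>
  The sequence decreases to some \<open>l \<ge> 0\<close>, and passing to the limit in
  \<open>\<beta> (n+1) + \<beta> (n+2) \<le> \<beta> n\<close> gives \<open>2 l \<le> l\<close>.
\<close>

lemma rem_tendsto_0: "\<beta> \<longlonglongrightarrow> 0"
proof -
  have "decseq \<beta>" using rem_Suc_less by (intro decseq_SucI) (simp add: less_imp_le)
  then obtain l where l: "\<beta> \<longlonglongrightarrow> l"
    using decseq_convergent[of \<beta> 0] rem_pos less_imp_le by metis
  have "(\<lambda>n. \<beta> (Suc n) + \<beta> (Suc (Suc n))) \<longlonglongrightarrow> l + l"
    using l by (intro tendsto_intros LIMSEQ_Suc)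
  moreover have "\<beta> (Suc n) + \<beta> (Suc (Suc n)) \<le> \<beta> n" for n
    using quotient_mult_ge[of n] rem_rec[of n] by linarith
  ultimately have "l + l \<le> l" using l by (intro LIMSEQ_le[of _ _ \<beta>]) auto
  moreover have "0 \<le> l" using l rem_pos less_imp_le by (intro LIMSEQ_le_const[of \<beta>]) auto
  ultimately show ?thesis using l by simp
qed

text \<open>
  Digits of an expansion of level \<open>n\<close> are numbered from \<open>0\<close>, so that removing the first digit is a
  shift of the digit sequence and raises the level by one.
\<close>

definition expands :: "nat \<Rightarrow> (nat \<Rightarrow> nat) \<Rightarrow> real \<Rightarrow> bool" where
  "expands n d t \<longleftrightarrow> (\<forall>k. d k \<le> a (Suc (n + k))) \<and> (\<lambda>k. real (d k) * \<beta> (Suc (n + k))) sums t"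

abbreviation uniquely_expands :: "nat \<Rightarrow> real \<Rightarrow> bool" where
  "uniquely_expands n t \<equiv> \<exists>!d. expands n d t"

lemma expands_step:
  "expands n d t \<longleftrightarrow>
    d 0 \<le> a (Suc n) \<and> expands (Suc n) (\<lambda>k. d (Suc k)) (t - real (d 0) * \<beta> (Suc n))"
proof -
  have "(\<forall>k. d k \<le> a (Suc (n + k))) \<longleftrightarrow>
      d 0 \<le> a (Suc n) \<and> (\<forall>k. d (Suc k) \<le> a (Suc (Suc n + k)))"
    by (metis add_Suc add_Suc_right add_0_right not0_implies_Suc)
  moreover have "(\<lambda>k. real (d k) * \<beta> (Suc (n + k))) sums t \<longleftrightarrow>
      (\<lambda>k. real (d (Suc k)) * \<beta> (Suc (Suc n + k))) sums (t - real (d 0) * \<beta> (Suc n))"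
    using sums_Suc_iff[of "\<lambda>k. real (d k) * \<beta> (Suc (n + k))" "t - real (d 0) * \<beta> (Suc n)"] by simp
  ultimately show ?thesis unfolding expands_def by blast
qed

lemma expands_case_nat:
  "expands n (case_nat j d) t \<longleftrightarrow> j \<le> a (Suc n) \<and> expands (Suc n) d (t - real j * \<beta> (Suc n))"
  by (subst expands_step) simp

text \<open>The sum with all digits maximal telescopes by the recurrence.\<close>

lemma expands_bounds:
  assumes "expands n d t"
  shows "0 \<le> t" and "t \<le> \<beta> n + \<beta> (Suc n)"
proof -
  have s: "(\<lambda>k. real (d k) * \<beta> (Suc (n + k))) sums t" and d: "\<And>k. d k \<le> a (Suc (n + k))"
    using assms by (auto simp: expands_def)
  show "0 \<le> t"
    by (rule sums_le[OF _ sums_zero s]) (simp add: rem_pos less_imp_le)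
  have "(\<Sum>k<m. real (d k) * \<beta> (Suc (n + k))) \<le> \<beta> n + \<beta> (Suc n) - \<beta> (n + m) - \<beta> (Suc (n + m))" for m
  proof (induction m)
    case (Suc m)
    have "real (d m) * \<beta> (Suc (n + m)) \<le> real (a (Suc (n + m))) * \<beta> (Suc (n + m))"
      using d rem_pos[of "Suc (n + m)"] by (intro mult_right_mono) auto
    then show ?case using Suc.IH rem_rec[of "n + m"] by simp
  qed simp
  then have "(\<Sum>k<m. real (d k) * \<beta> (Suc (n + k))) \<le> \<beta> n + \<beta> (Suc n)" for m
    using rem_pos[of "n + m"] rem_pos[of "Suc (n + m)"] by (smt (verit))
  then show "t \<le> \<beta> n + \<beta> (Suc n)"
    using s unfolding sums_def by (intro LIMSEQ_le_const2[of _ t]) auto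
qed

text \<open>
  The greedy digit, capped at \<open>a (n+1)\<close>. If the cap is active, the recurrence bounds the remainder;
  otherwise the remainder is even smaller than \<open>\<beta> (n+1)\<close>.
\<close>

lemma admissible_digit_exists:
  assumes "0 \<le> t" and "t \<le> \<beta> n + \<beta> (Suc n)"
  shows "\<exists>j \<le> a (Suc n). 0 \<le> t - real j * \<beta> (Suc n) \<and>
    t - real j * \<beta> (Suc n) \<le> \<beta> (Suc n) + \<beta> (Suc (Suc n))"
proof (cases "real (a (Suc n)) * \<beta> (Suc n) \<le> t")
  case True
  then show ?thesis using assms rem_rec[of n] by (intro exI[of _ "a (Suc n)"]) auto
next
  case False
  have b: "\<beta> (Suc n) > 0" by (rule rem_pos)
  define j where "j = nat \<lfloor>t / \<beta> (Suc n)\<rfloor>"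
  have "0 \<le> t / \<beta> (Suc n)" using b assms by simp
  then have "real j \<le> t / \<beta> (Suc n)" "t / \<beta> (Suc n) < real j + 1"
    unfolding j_def by linarith+
  then have j: "real j * \<beta> (Suc n) \<le> t" "t < real j * \<beta> (Suc n) + \<beta> (Suc n)"
    using b by (simp_all add: field_simps)
  have "real j * \<beta> (Suc n) < real (a (Suc n)) * \<beta> (Suc n)" using j(1) False by linarith
  then have "j \<le> a (Suc n)" using b by simp
  then show ?thesis using j rem_pos[of "Suc (Suc n)"] by (intro exI[of _ j]) auto
qed

text \<open>
  Iterating the choice of a digit gives remainders that are bounded by
  \<open>\<beta> (n+k) + \<beta> (n+k+1)\<close> and hence vanish in the limit.
\<close>

lemma expands_exists:
  assumes "0 \<le> t" and "t \<le> \<beta> n + \<beta> (Suc n)"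
  shows "\<exists>d. expands n d t"
proof -
  define G where "G k r \<longleftrightarrow> 0 \<le> r \<and> r \<le> \<beta> (n + k) + \<beta> (Suc (n + k))" for k and r :: real
  have "\<exists>r. \<forall>k. (G k (r k) \<and> (k = 0 \<longrightarrow> r k = t)) \<and>
      (\<exists>j \<le> a (Suc (n + k)). r (Suc k) = r k - real j * \<beta> (Suc (n + k)))"
  proof (rule dependent_nat_choice)
    show "\<exists>x. G 0 x \<and> (0 = (0::nat) \<longrightarrow> x = t)" using assms by (auto simp: G_def)
  next
    fix x k assume x: "G k x \<and> (k = 0 \<longrightarrow> x = t)"
    then obtain j where "j \<le> a (Suc (n + k))" "G (Suc k) (x - real j * \<beta> (Suc (n + k)))"
      using admissible_digit_exists[of x "n + k"] unfolding G_def by auto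
    then show "\<exists>y. (G (Suc k) y \<and> (Suc k = 0 \<longrightarrow> y = t)) \<and>
        (\<exists>j\<le>a (Suc (n + k)). y = x - real j * \<beta> (Suc (n + k)))"
      by blast
  qed
  then obtain r where r: "\<And>k. G k (r k)" "r 0 = t"
    and step: "\<And>k. \<exists>j \<le> a (Suc (n + k)). r (Suc k) = r k - real j * \<beta> (Suc (n + k))"
    by metis
  obtain d where d: "\<And>k. d k \<le> a (Suc (n + k))"
      "\<And>k. r (Suc k) = r k - real (d k) * \<beta> (Suc (n + k))"
    using step by metis
  have partial: "(\<Sum>k<m. real (d k) * \<beta> (Suc (n + k))) = t - r m" for m
    by (induction m) (auto simp: r(2) d(2))
  have "r \<longlonglongrightarrow> 0"
  proof (rule tendsto_sandwich)
    show "\<forall>\<^sub>F k in sequentially. 0 \<le> r k" "\<forall>\<^sub>F k in sequentially. r k \<le> \<beta> (k + n) + \<beta> (k + Suc n)"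
      using r(1) by (auto simp: G_def add.commute)
    show "(\<lambda>k. \<beta> (k + n) + \<beta> (k + Suc n)) \<longlonglongrightarrow> 0"
      using tendsto_add[OF LIMSEQ_ignore_initial_segment[OF rem_tendsto_0, of n]
          LIMSEQ_ignore_initial_segment[OF rem_tendsto_0, of "Suc n"]] by simp
  qed simp
  then have "(\<lambda>m. t - r m) \<longlonglongrightarrow> t - 0" by (intro tendsto_intros)
  then have "(\<lambda>k. real (d k) * \<beta> (Suc (n + k))) sums t" unfolding sums_def partial by simp
  then show ?thesis using d(1) by (auto simp: expands_def)
qed

section \<open>Which numbers have a unique expansion\<close>

lemma uniquely_expands_tail:
  assumes "uniquely_expands n t" and "expands n d t"
  shows "uniquely_expands (Suc n) (t - real (d 0) * \<beta> (Suc n))"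
proof (rule ex1I)
  show "expands (Suc n) (\<lambda>k. d (Suc k)) (t - real (d 0) * \<beta> (Suc n))"
    using assms(2) expands_step by blast
next
  fix e assume "expands (Suc n) e (t - real (d 0) * \<beta> (Suc n))"
  then have "expands n (case_nat (d 0) e) t"
    using assms(2) expands_step expands_case_nat by blast
  then have "case_nat (d 0) e = d" using assms by blast
  then show "e = (\<lambda>k. d (Suc k))" by (metis nat.case(2) ext)
qed

text \<open>A nonzero first digit already contributes at least \<open>\<beta> (n+1) > t\<close>, so the first digit is \<open>0\<close>.\<close>

lemma uniquely_expands_Suc_iff:
  assumes "t < \<beta> (Suc n)"
  shows "uniquely_expands (Suc n) t \<longleftrightarrow> uniquely_expands n t"
proof -
  have zero: "d 0 = 0" if "expands n d t" for d
  proof (rule ccontr)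
    assume "d 0 \<noteq> 0"
    then have "\<beta> (Suc n) \<le> real (d 0) * \<beta> (Suc n)" using rem_pos[of "Suc n"] by simp
    moreover have "0 \<le> t - real (d 0) * \<beta> (Suc n)"
      using that expands_step expands_bounds(1) by blast
    ultimately show False using assms by linarith
  qed
  show ?thesis
  proof
    assume u: "uniquely_expands (Suc n) t"
    then obtain d where d: "expands (Suc n) d t" by blast
    show "uniquely_expands n t"
    proof (rule ex1I)
      show "expands n (case_nat 0 d) t" using d by (simp add: expands_case_nat)
    next
      fix e assume e: "expands n e t"
      then have "expands (Suc n) (\<lambda>k. e (Suc k)) t" using expands_step[of n e t] zero[OF e] by simp
      then have "(\<lambda>k. e (Suc k)) = d" using u d by blast
      then show "e = case_nat 0 d" using zero[OF e] by (auto simp: fun_eq_iff split: nat.split)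
    qed
  next
    assume u: "uniquely_expands n t"
    then obtain d where "expands n d t" by blast
    then show "uniquely_expands (Suc n) t" using uniquely_expands_tail[OF u] zero by fastforce
  qed
qed

lemma uniquely_expands_iff_0:
  assumes "t < \<beta> n"
  shows "uniquely_expands n t \<longleftrightarrow> uniquely_expands 0 t"
  using assms
proof (induction n)
  case (Suc n)
  then show ?case using uniquely_expands_Suc_iff[of t n] rem_Suc_less[of n] by linarith
qed simp

text \<open>
  The \<open>m\<close>-th stage of the Cantor-like construction in the middle gap of level \<open>n\<close>: the points for
  which \<open>m\<close> successive digits can be chosen from \<open>{1..<a k}\<close> such that the remainder lies in the middle
  gap of level \<open>n + m\<close>.
\<close>

fun middle_cover :: "nat \<Rightarrow> nat \<Rightarrow> real set" where
  "middle_cover n 0 = {\<beta> (Suc n)<..<\<beta> n}"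
| "middle_cover n (Suc m) =
    (\<Union>j\<in>{1..<a (Suc n)}. (+) (real j * \<beta> (Suc n)) ` middle_cover (Suc n) m)"

text \<open>
  By uniqueness the remainder \<open>r\<close> is in no overlap: if it were at least \<open>\<beta> (n+1)\<close>, the digit \<open>j\<close>
  could be raised, and if it were at most \<open>\<beta> (n+2)\<close>, the digit could be lowered, since
  \<open>expands_exists\<close> would expand the new remainder. The extreme digits escape one of the two
  conditions but then put \<open>t\<close> outside the middle gap.
\<close>

lemma uniquely_expands_middle_step:
  assumes u: "uniquely_expands n t" and t: "\<beta> (Suc n) < t" "t < \<beta> n"
  obtains j where "j \<in> {1..<a (Suc n)}" "uniquely_expands (Suc n) (t - real j * \<beta> (Suc n))"
    "\<beta> (Suc (Suc n)) < t - real j * \<beta> (Suc n)" "t - real j * \<beta> (Suc n) < \<beta> (Suc n)"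
proof -
  obtain d where d: "expands n d t" using u by blast
  define j where "j = d 0"
  define r where "r = t - real j * \<beta> (Suc n)"
  have j: "j \<le> a (Suc n)" and r: "expands (Suc n) (\<lambda>k. d (Suc k)) r"
    using d expands_step[of n d t] by (auto simp: j_def r_def)
  note rb = expands_bounds[OF r]
  have same: "i = j" if i: "i \<le> a (Suc n)" and "0 \<le> t - real i * \<beta> (Suc n)"
    and "t - real i * \<beta> (Suc n) \<le> \<beta> (Suc n) + \<beta> (Suc (Suc n))" for i
  proof -
    from expands_exists[OF that(2,3)] obtain e
      where "expands (Suc n) e (t - real i * \<beta> (Suc n))" by blast
    then have "expands n (case_nat i e) t" using i by (simp add: expands_case_nat)
    then have "case_nat i e = d" using u d by blast
    then show ?thesis unfolding j_def by (metis nat.case(1))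
  qed
  have up: "r < \<beta> (Suc n)" if "j < a (Suc n)"
  proof (rule ccontr)
    assume "\<not> r < \<beta> (Suc n)"
    then have "Suc j = j"
      using that rb rem_pos[of "Suc n"] by (intro same) (auto simp: r_def algebra_simps)
    then show False by simp
  qed
  have low: "\<beta> (Suc (Suc n)) < r" if "j > 0"
  proof (rule ccontr)
    assume "\<not> \<beta> (Suc (Suc n)) < r"
    then have "j - 1 = j"
      using that j rb rem_pos[of "Suc n"]
      by (intro same) (auto simp: r_def algebra_simps of_nat_diff Suc_le_eq)
    then show False using that by simp
  qed
  have "j \<noteq> 0"
  proof
    assume "j = 0"
    then show False using up quotient_ge_1[of n] t by (simp add: r_def)
  qed
  moreover have "j \<noteq> a (Suc n)"
  proof
    assume "j = a (Suc n)"
    then show False using low \<open>j \<noteq> 0\<close> t rem_rec[of n] by (simp add: r_def)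
  qed
  ultimately have "j \<in> {1..<a (Suc n)}" using j by auto
  moreover have "uniquely_expands (Suc n) r"
    using uniquely_expands_tail[OF u d] by (simp add: r_def j_def)
  ultimately show ?thesis using up low by (intro that[of j]) (auto simp: r_def)
qed

lemma uniquely_expands_imp_middle_cover:
  assumes "uniquely_expands n t" and "\<beta> (Suc n) < t" "t < \<beta> n"
  shows "t \<in> middle_cover n m"
  using assms
proof (induction m arbitrary: n t)
  case (Suc m)
  obtain j where j: "j \<in> {1..<a (Suc n)}" "uniquely_expands (Suc n) (t - real j * \<beta> (Suc n))"
    "\<beta> (Suc (Suc n)) < t - real j * \<beta> (Suc n)" "t - real j * \<beta> (Suc n) < \<beta> (Suc n)"
    using uniquely_expands_middle_step[OF Suc.prems] .
  have "t - real j * \<beta> (Suc n) \<in> middle_cover (Suc n) m" using Suc.IH j by blast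
  then have "t \<in> (+) (real j * \<beta> (Suc n)) ` middle_cover (Suc n) m"
    by (intro image_eqI[of _ _ "t - real j * \<beta> (Suc n)"]) auto
  then show ?case using j(1) by auto
qed simp

lemma middle_cover_subset: "middle_cover n m \<subseteq> {\<beta> (Suc n)<..<\<beta> n}"
proof (induction m arbitrary: n)
  case (Suc m)
  show ?case
  proof
    fix t assume "t \<in> middle_cover n (Suc m)"
    then obtain j r where j: "1 \<le> j" "Suc j \<le> a (Suc n)" and t: "t = real j * \<beta> (Suc n) + r"
      and r: "0 < r" "r < \<beta> (Suc n)"
      using Suc.IH[of "Suc n"] rem_pos[of "Suc (Suc n)"] by fastforce
    have "real 1 * \<beta> (Suc n) \<le> real j * \<beta> (Suc n)"
      "real (Suc j) * \<beta> (Suc n) \<le> real (a (Suc n)) * \<beta> (Suc n)"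
      using j rem_pos[of "Suc n"] by (intro mult_right_mono; simp)+
    then have "\<beta> (Suc n) \<le> real j * \<beta> (Suc n)"
      "real j * \<beta> (Suc n) + \<beta> (Suc n) \<le> real (a (Suc n)) * \<beta> (Suc n)"
      by (simp_all add: algebra_simps)
    then show "t \<in> {\<beta> (Suc n)<..<\<beta> n}"
      using r rem_rec[of n] rem_pos[of "Suc (Suc n)"] unfolding t greaterThanLessThan_iff
      by linarith
  qed
qed simp

lemma middle_cover_Suc_subset: "middle_cover n (Suc m) \<subseteq> middle_cover n m"
proof (induction m arbitrary: n)
  case 0
  show ?case using middle_cover_subset[of n "Suc 0"] by simp
next
  case (Suc m)
  show ?case unfolding middle_cover.simps(2)[of n "Suc m"] middle_cover.simps(2)[of n m]
    using Suc.IH by (intro UN_mono image_mono) auto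
qed

lemma digit_determined:
  assumes "0 < t - real i * \<beta> (Suc n)" "t - real i * \<beta> (Suc n) < \<beta> (Suc n)"
    and "0 < t - real j * \<beta> (Suc n)" "t - real j * \<beta> (Suc n) < \<beta> (Suc n)"
  shows "i = j"
proof -
  have "real i * \<beta> (Suc n) < real (Suc j) * \<beta> (Suc n)"
    "real j * \<beta> (Suc n) < real (Suc i) * \<beta> (Suc n)"
    using assms by (simp_all add: algebra_simps)
  then have "real i < real (Suc j)" "real j < real (Suc i)"
    using rem_pos[of "Suc n"] mult_less_cancel_right_pos by blast+
  then show ?thesis by linarith
qed

text \<open>
  Any other digit would leave a remainder that is negative or exceeds
  \<open>\<beta> (n+1) + \<beta> (n+2)\<close>, the largest value of an expansion of level \<open>n + 1\<close>.
\<close>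

lemma forced_digit:
  assumes "expands n d t" and "\<beta> (Suc (Suc n)) < t - real j * \<beta> (Suc n)"
    and "t - real j * \<beta> (Suc n) < \<beta> (Suc n)"
  shows "d 0 = j"
proof -
  have b: "0 \<le> t - real (d 0) * \<beta> (Suc n)"
    "t - real (d 0) * \<beta> (Suc n) \<le> \<beta> (Suc n) + \<beta> (Suc (Suc n))"
    using assms(1) expands_step expands_bounds by blast+
  have "real (d 0) * \<beta> (Suc n) < real (Suc j) * \<beta> (Suc n)"
    "real j * \<beta> (Suc n) < real (Suc (d 0)) * \<beta> (Suc n)"
    using b assms(2,3) by (simp_all add: algebra_simps)
  then have "real (d 0) < real (Suc j)" "real j < real (Suc (d 0))"
    using rem_pos[of "Suc n"] mult_less_cancel_right_pos by blast+
  then show ?thesis by linarith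
qed

text \<open>
  Every stage provides some first digit; since its remainder lies in \<open>(0, \<beta> (n+1))\<close>, the digit is the
  same for all stages.
\<close>

lemma middle_core_step:
  assumes "\<And>m. t \<in> middle_cover n m"
  obtains j where "\<And>m. t - real j * \<beta> (Suc n) \<in> middle_cover (Suc n) m"
proof -
  have ex: "\<exists>j. t - real j * \<beta> (Suc n) \<in> middle_cover (Suc n) m" for m
  proof -
    obtain j r where "t = real j * \<beta> (Suc n) + r" "r \<in> middle_cover (Suc n) m"
      using assms[of "Suc m"] by auto
    then have "t - real j * \<beta> (Suc n) \<in> middle_cover (Suc n) m" by simp
    then show ?thesis by blast
  qed
  obtain j where j: "t - real j * \<beta> (Suc n) \<in> middle_cover (Suc n) 0" using ex by blast
  have "t - real j * \<beta> (Suc n) \<in> middle_cover (Suc n) m" for m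
  proof -
    obtain i where i: "t - real i * \<beta> (Suc n) \<in> middle_cover (Suc n) m" using ex by blast
    have "0 < t - real j * \<beta> (Suc n)" "t - real j * \<beta> (Suc n) < \<beta> (Suc n)"
      "0 < t - real i * \<beta> (Suc n)" "t - real i * \<beta> (Suc n) < \<beta> (Suc n)"
      using i j middle_cover_subset[of "Suc n" m] rem_pos[of "Suc (Suc n)"] by fastforce+
    then have "i = j" by (intro digit_determined)
    then show ?thesis using i by simp
  qed
  then show ?thesis by (rule that)
qed

text \<open>The digits are forced one after the other, by induction on the position.\<close>

lemma middle_core_uniquely_expands:
  assumes "\<And>m. t \<in> middle_cover n m"
  shows "uniquely_expands n t"
proof -
  have "d k = e k" if "expands n d t" "expands n e t" "\<And>m. t \<in> middle_cover n m" for d e n t k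
    using that
  proof (induction k arbitrary: n t d e)
    case (0 n t d e)
    obtain j where j: "\<And>m. t - real j * \<beta> (Suc n) \<in> middle_cover (Suc n) m"
      using middle_core_step[OF "0.prems"(3)] by blast
    have "d 0 = j" "e 0 = j"
      using j[of 0] by (auto intro!: forced_digit[of n _ t] "0.prems")
    then show ?case by simp
  next
    case (Suc k n t d e)
    obtain j where j: "\<And>m. t - real j * \<beta> (Suc n) \<in> middle_cover (Suc n) m"
      using middle_core_step[OF Suc.prems(3)] by blast
    have 0: "d 0 = j" "e 0 = j"
      using j[of 0] by (auto intro!: forced_digit[of n _ t] Suc.prems)
    show ?case
      using Suc.IH[of "Suc n" "\<lambda>k. d (Suc k)" "t - real j * \<beta> (Suc n)" "\<lambda>k. e (Suc k)"]
        Suc.prems(1,2) 0 j expands_step[of n d t] expands_step[of n e t] by simp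
  qed
  then have eq: "d = e" if "expands n d t" "expands n e t" for d e
    using that assms by blast
  have "\<beta> (Suc n) < t" "t < \<beta> n" using assms[of 0] by auto
  then have "\<exists>d. expands n d t"
    using rem_pos[of "Suc n"] by (intro expands_exists) auto
  with eq show ?thesis by blast
qed

section \<open>Measure\<close>

lemma middle_cover_lmeasurable: "middle_cover n m \<in> lmeasurable"
proof (induction m arbitrary: n)
  case (Suc m)
  then show ?case by (auto intro!: fmeasurable.finite_UN measurable_translation)
qed simp

lemma measure_middle_cover:
  "measure lebesgue (middle_cover n m) =
    (\<Prod>k<m. real (a (Suc (n + k))) - 1) * (\<beta> (n + m) - \<beta> (Suc (n + m)))"
proof (induction m arbitrary: n)
  case 0
  show ?case using rem_Suc_less[of n] by simp
next
  case (Suc m)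
  let ?T = "\<lambda>j. (+) (real j * \<beta> (Suc n)) ` middle_cover (Suc n) m"
  have lm: "?T j \<in> lmeasurable" for j
    by (intro measurable_translation middle_cover_lmeasurable)
  have "disjoint_family_on ?T {1..<a (Suc n)}"
    unfolding disjoint_family_on_def
  proof (intro ballI impI, rule ccontr)
    fix i j :: nat assume ij: "i \<noteq> j" and "?T i \<inter> ?T j \<noteq> {}"
    then obtain r s where rs: "r \<in> middle_cover (Suc n) m" "s \<in> middle_cover (Suc n) m"
      "real i * \<beta> (Suc n) + r = real j * \<beta> (Suc n) + s" by blast
    then have "0 < r" "r < \<beta> (Suc n)" "0 < s" "s < \<beta> (Suc n)"
      using middle_cover_subset[of "Suc n" m] rem_pos[of "Suc (Suc n)"] by fastforce+
    then have "i = j"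
      using rs(3) by (intro digit_determined[of "real i * \<beta> (Suc n) + r" i n j]) simp_all
    then show False using ij by simp
  qed
  then have "measure lebesgue (middle_cover n (Suc m)) = (\<Sum>j\<in>{1..<a (Suc n)}. measure lebesgue (?T j))"
    unfolding middle_cover.simps
    using fmeasurableD[OF lm] fmeasurableD2[OF lm]
    by (intro measure_finite_Union) (blast | simp only: infinity_ennreal_def)+
  also have "\<dots> = (real (a (Suc n)) - 1) * measure lebesgue (middle_cover (Suc n) m)"
    using quotient_ge_1[of n] by (simp add: measure_translation of_nat_diff)
  finally show ?case unfolding Suc.IH by (simp only: prod.lessThan_Suc_shift) simp
qed

text \<open>Each factor \<open>a k - 1\<close> is weighed against \<open>a k * \<beta> k \<le> \<beta> (k-1)\<close>.\<close>

lemma measure_middle_cover_le: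
  "measure lebesgue (middle_cover n m) \<le> \<beta> n * (\<Prod>k<m. 1 - 1 / real (a (Suc (n + k))))"
proof -
  have "(\<Prod>k<m. real (a (Suc (n + k))) - 1) * \<beta> (n + m) \<le> \<beta> n * (\<Prod>k<m. 1 - 1 / real (a (Suc (n + k))))"
  proof (induction m)
    case (Suc m)
    let ?P = "\<Prod>k<m. real (a (Suc (n + k))) - 1" and ?c = "real (a (Suc (n + m)))"
    have P: "0 \<le> ?P" and c: "?c \<ge> 1" using quotient_ge_1 by (auto intro!: prod_nonneg)
    have "?c * \<beta> (Suc (n + m)) \<le> \<beta> (n + m)"
      using rem_rec[of "n + m"] rem_pos[of "Suc (Suc (n + m))"] by linarith
    then have "\<beta> (Suc (n + m)) \<le> \<beta> (n + m) / ?c" using c by (simp add: field_simps)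
    then have "?P * (?c - 1) * \<beta> (Suc (n + m)) \<le> ?P * (?c - 1) * (\<beta> (n + m) / ?c)"
      using P c by (intro mult_left_mono) auto
    also have "\<dots> = (?P * \<beta> (n + m)) * (1 - 1 / ?c)" using c by (simp add: field_simps)
    also have "\<dots> \<le> (\<beta> n * (\<Prod>k<m. 1 - 1 / real (a (Suc (n + k))))) * (1 - 1 / ?c)"
      using Suc.IH c by (intro mult_right_mono) auto
    finally show ?case by (simp add: mult.assoc)
  qed simp
  moreover have "(\<Prod>k<m. real (a (Suc (n + k))) - 1) * (\<beta> (n + m) - \<beta> (Suc (n + m))) \<le>
      (\<Prod>k<m. real (a (Suc (n + k))) - 1) * \<beta> (n + m)"
    using quotient_ge_1 rem_pos[of "Suc (n + m)"] by (intro mult_left_mono prod_nonneg) auto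
  ultimately show ?thesis unfolding measure_middle_cover by linarith
qed

text \<open>
  With \<open>x\<^sub>k = 1 / a k\<close>, the bound \<open>\<beta> (k-1) \<le> (a k + 1) \<beta> k\<close> and
  \<open>(a k - 1) / (a k + 1) \<ge> 1 - 2 x\<^sub>k\<close> give a product that the Weierstrass inequality keeps above
  \<open>1 - 2 * (1/4) = 1/2\<close>. A second factor \<open>1/2\<close> comes from
  \<open>\<beta> (n+m) - \<beta> (n+m+1) \<ge> \<beta> (n+m) / 2\<close>; this is why the sum includes the index \<open>m\<close>, one more than
  the product.
\<close>

lemma measure_middle_cover_ge:
  assumes "(\<Sum>k\<le>m. 1 / real (a (Suc (n + k)))) \<le> 1 / 4"
  shows "\<beta> n / 4 \<le> measure lebesgue (middle_cover n m)"
proof -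
  let ?x = "\<lambda>k. 1 / real (a (Suc (n + k)))"
  have small: "?x k \<le> 1 / 4" if "k \<le> m" for k
    using member_le_sum[of k "{..m}" ?x] that assms by auto
  have prod_le: "\<beta> n * (\<Prod>k<i. 1 - 2 * ?x k) \<le> (\<Prod>k<i. real (a (Suc (n + k))) - 1) * \<beta> (n + i)"
    if "i \<le> m" for i
    using that
  proof (induction i)
    case (Suc i)
    let ?P = "\<Prod>k<i. real (a (Suc (n + k))) - 1" and ?c = "real (a (Suc (n + i)))"
    have P: "0 \<le> ?P" and c: "?c \<ge> 1" using quotient_ge_1 by (auto intro!: prod_nonneg)
    have x: "0 \<le> 1 - 2 * ?x i" using small[of i] Suc.prems by simp
    have b: "\<beta> (n + i) \<le> (?c + 1) * \<beta> (Suc (n + i))"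
      using rem_rec[of "n + i"] rem_Suc_less[of "Suc (n + i)"] by (simp add: algebra_simps)
    have "(1 - 2 * ?x i) * (?c + 1) = ?c - 1 - 2 / ?c" using c by (simp add: field_simps)
    then have x1: "(1 - 2 * ?x i) * (?c + 1) \<le> ?c - 1" using c by simp
    have "\<beta> n * (\<Prod>k<Suc i. 1 - 2 * ?x k) \<le> (?P * \<beta> (n + i)) * (1 - 2 * ?x i)"
      using Suc x mult_right_mono[OF Suc.IH x] by (simp add: mult.assoc)
    also have "\<dots> \<le> (?P * ((?c + 1) * \<beta> (Suc (n + i)))) * (1 - 2 * ?x i)"
      using b P x by (intro mult_right_mono mult_left_mono)
    also have "\<dots> = ?P * \<beta> (Suc (n + i)) * ((1 - 2 * ?x i) * (?c + 1))" by (simp add: mult_ac)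
    also have "\<dots> \<le> ?P * \<beta> (Suc (n + i)) * (?c - 1)"
      using x1 P rem_pos[of "Suc (n + i)"] by (intro mult_left_mono) auto
    finally show ?case by (simp add: mult_ac)
  qed simp
  have "1 - (\<Sum>k<m. 2 * ?x k) \<le> (\<Prod>k<m. 1 - 2 * ?x k)"
  proof (rule Weierstrass_prod_ineq)
    fix k assume "k \<in> {..<m}"
    then have "?x k \<le> 1 / 4" by (intro small) simp
    moreover have "0 \<le> ?x k" by simp
    ultimately show "2 * ?x k \<in> {0..1}" unfolding atLeastAtMost_iff by linarith
  qed
  moreover have "(\<Sum>k<m. 2 * ?x k) \<le> 1 / 2"
  proof -
    have "(\<Sum>k<m. ?x k) \<le> (\<Sum>k\<le>m. ?x k)" by (intro sum_mono2) auto
    then show ?thesis using assms unfolding sum_distrib_left[symmetric] by linarith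
  qed
  ultimately have "1 / 2 \<le> (\<Prod>k<m. 1 - 2 * ?x k)" by linarith
  then have "\<beta> n * (1 / 2) \<le> \<beta> n * (\<Prod>k<m. 1 - 2 * ?x k)"
    using rem_pos[of n] by (intro mult_left_mono) auto
  then have half: "\<beta> n / 2 \<le> (\<Prod>k<m. real (a (Suc (n + k))) - 1) * \<beta> (n + m)"
    using prod_le[of m] by simp
  have "\<beta> (Suc (n + m)) \<le> \<beta> (n + m) / 2"
  proof -
    have "2 \<le> real (a (Suc (n + m)))"
      using small[of m] quotient_ge_1[of "n + m"] by (simp add: field_simps)
    then have "2 * \<beta> (Suc (n + m)) \<le> real (a (Suc (n + m))) * \<beta> (Suc (n + m))"
      using rem_pos[of "Suc (n + m)"] by (intro mult_right_mono) auto
    then show ?thesis using rem_rec[of "n + m"] rem_pos[of "Suc (Suc (n + m))"] by linarith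
  qed
  then have "(\<Prod>k<m. real (a (Suc (n + k))) - 1) * (\<beta> (n + m) / 2) \<le>
      (\<Prod>k<m. real (a (Suc (n + k))) - 1) * (\<beta> (n + m) - \<beta> (Suc (n + m)))"
    using quotient_ge_1 by (intro mult_left_mono prod_nonneg) auto
  then show ?thesis unfolding measure_middle_cover using half by simp
qed

lemma middle_core_negligible_iff:
  "(\<Inter>m. middle_cover n m) \<in> null_sets lebesgue \<longleftrightarrow>
    (\<lambda>m. measure lebesgue (middle_cover n m)) \<longlonglongrightarrow> 0"
proof -
  let ?K = "\<Inter>m. middle_cover n m"
  have lim: "(\<lambda>m. measure lebesgue (middle_cover n m)) \<longlonglongrightarrow> measure lebesgue ?K"
    using fmeasurableD[OF middle_cover_lmeasurable] fmeasurableD2[OF middle_cover_lmeasurable]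
      middle_cover_Suc_subset
    by (intro Lim_measure_decseq decseq_SucI) (blast | simp only: infinity_ennreal_def)+
  have "?K \<in> lmeasurable"
  proof (rule fmeasurableI2[OF middle_cover_lmeasurable[of n 0]])
    show "?K \<subseteq> middle_cover n 0" by blast
    show "?K \<in> sets lebesgue"
      by (intro sets.countable_INT'') (simp_all add: fmeasurableD[OF middle_cover_lmeasurable])
  qed
  then have "?K \<in> null_sets lebesgue \<longleftrightarrow> measure lebesgue ?K = 0"
    by (simp add: null_sets_def emeasure_eq_measure2 fmeasurableD)
  then show ?thesis using lim LIMSEQ_unique by metis
qed

text \<open>
  Estimating \<open>1 - x \<le> exp (- x)\<close> in the upper bound shows that the core of every level is null. Every
  \<open>t < \<beta> 0\<close> has a level \<open>n\<close> with \<open>\<beta> (n+1) \<le> t < \<beta> n\<close>, and is either the left end point or in the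
  core of level \<open>n\<close>.
\<close>

lemma uniquely_expands_null_if_divergent:
  assumes "filterlim (\<lambda>N. \<Sum>n=1..N. 1 / real (a n)) at_top sequentially"
  shows "{t \<in> {0<..<\<beta> 0}. uniquely_expands 0 t} \<in> null_sets lebesgue"
proof -
  let ?K = "\<lambda>n. \<Inter>m. middle_cover n m"
  have K: "?K n \<in> null_sets lebesgue" for n
  proof -
    have tail: "(\<Sum>k<m. 1 / real (a (Suc (n + k)))) =
        (\<Sum>k=1..m + n. 1 / real (a k)) - (\<Sum>k=1..n. 1 / real (a k))" for m
      by (induction m) (auto simp: add.commute)
    have "filterlim (\<lambda>m. \<Sum>k=1..m + n. 1 / real (a k)) at_top sequentially"
      using filterlim_compose[OF assms filterlim_add_const_nat_at_top] .
    then have div: "filterlim (\<lambda>m. \<Sum>k<m. 1 / real (a (Suc (n + k)))) at_top sequentially"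
      unfolding tail diff_conv_add_uminus
      by (subst add.commute) (rule filterlim_tendsto_add_at_top[OF tendsto_const])
    have e: "measure lebesgue (middle_cover n m) \<le>
        \<beta> n * exp (- (\<Sum>k<m. 1 / real (a (Suc (n + k)))))" for m
    proof -
      have "(\<Prod>k<m. 1 - 1 / real (a (Suc (n + k)))) \<le> (\<Prod>k<m. exp (- (1 / real (a (Suc (n + k))))))"
      proof (intro prod_mono conjI)
        fix k
        show "0 \<le> 1 - 1 / real (a (Suc (n + k)))" using quotient_ge_1[of "n + k"] by simp
        show "1 - 1 / real (a (Suc (n + k))) \<le> exp (- (1 / real (a (Suc (n + k)))))"
          using exp_ge_add_one_self[of "- (1 / real (a (Suc (n + k))))"] by simp
      qed
      also have "\<dots> = exp (- (\<Sum>k<m. 1 / real (a (Suc (n + k)))))"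
        by (simp add: exp_sum sum_negf[symmetric])
      finally have "\<beta> n * (\<Prod>k<m. 1 - 1 / real (a (Suc (n + k)))) \<le>
          \<beta> n * exp (- (\<Sum>k<m. 1 / real (a (Suc (n + k)))))"
        using rem_pos[of n] by (intro mult_left_mono) auto
      then show ?thesis using measure_middle_cover_le[of n m] by linarith
    qed
    have "(\<lambda>m. exp (- (\<Sum>k<m. 1 / real (a (Suc (n + k)))))) \<longlonglongrightarrow> 0"
      using div by (intro filterlim_compose[OF exp_at_bot]) (simp add: filterlim_uminus_at_bot)
    then have "(\<lambda>m. \<beta> n * exp (- (\<Sum>k<m. 1 / real (a (Suc (n + k)))))) \<longlonglongrightarrow> 0"
      by (rule tendsto_mult_right_zero)
    then have "(\<lambda>m. measure lebesgue (middle_cover n m)) \<longlonglongrightarrow> 0"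
      by (rule Lim_null_comparison[rotated]) (simp add: e always_eventually)
    then show ?thesis by (simp add: middle_core_negligible_iff)
  qed
  have "{t \<in> {0<..<\<beta> 0}. uniquely_expands 0 t} \<subseteq> (\<Union>n. ?K n) \<union> range \<beta>"
  proof
    fix t assume "t \<in> {t \<in> {0<..<\<beta> 0}. uniquely_expands 0 t}"
    then have t: "0 < t" "t < \<beta> 0" "uniquely_expands 0 t" by auto
    have "\<exists>n. \<beta> (Suc n) \<le> t"
    proof -
      have "\<forall>\<^sub>F n in sequentially. \<beta> n < t" using rem_tendsto_0 t(1) by (rule order_tendstoD)
      then obtain n where "\<beta> n < t" by (auto simp: eventually_sequentially)
      then show ?thesis using rem_Suc_less[of n] by (intro exI[of _ n]) simp
    qed
    \<comment> \<open>The least such \<open>n\<close> also satisfies \<open>t < \<beta> n\<close>.\<close>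
    define n where "n = (LEAST n. \<beta> (Suc n) \<le> t)"
    have n: "\<beta> (Suc n) \<le> t"
      unfolding n_def using \<open>\<exists>n. \<beta> (Suc n) \<le> t\<close> by (rule LeastI_ex)
    have least: "\<not> \<beta> (Suc i) \<le> t" if "i < n" for i
      using that unfolding n_def by (rule not_less_Least)
    have "t < \<beta> n" using t(2) least[of "n - 1"] by (cases n) auto
    then have "uniquely_expands n t" using t(3) by (simp only: uniquely_expands_iff_0)
    consider "t = \<beta> (Suc n)" | "\<beta> (Suc n) < t" using n by linarith
    then show "t \<in> (\<Union>n. ?K n) \<union> range \<beta>"
    proof cases
      case 1
      then show ?thesis by (intro UnI2) (rule image_eqI[OF _ UNIV_I])
    next
      case 2
      have "t \<in> ?K n"
        using uniquely_expands_imp_middle_cover[OF \<open>uniquely_expands n t\<close> 2 \<open>t < \<beta> n\<close>]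
        by (rule INT_I)
      then show ?thesis by (intro UnI1) (rule UN_I[OF UNIV_I])
    qed
  qed
  moreover have "(\<Union>n. ?K n) \<union> range \<beta> \<in> null_sets lebesgue"
  proof (rule null_sets.Un)
    show "(\<Union>n. ?K n) \<in> null_sets lebesgue" using K by (rule null_sets_UN)
    show "range \<beta> \<in> null_sets lebesgue"
      by (intro null_sets_completionI countable_imp_null_set_lborel) simp
  qed
  ultimately show ?thesis
    by (meson negligible_iff_null_sets negligible_subset)
qed

text \<open>
  Beyond a level \<open>N\<close> at which the tail of a convergent series is below \<open>1/4\<close>, the lower bound does not
  depend on the stage, so the core of level \<open>N\<close> would have positive measure.
\<close>

lemma divergent_if_uniquely_expands_null:
  assumes "{t \<in> {0<..<\<beta> 0}. uniquely_expands 0 t} \<in> null_sets lebesgue"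
  shows "filterlim (\<lambda>N. \<Sum>n=1..N. 1 / real (a n)) at_top sequentially"
proof (rule ccontr)
  assume not: "\<not> ?thesis"
  have shift: "(\<Sum>n=1..N. 1 / real (a n)) = (\<Sum>k<N. 1 / real (a (Suc k)))" for N
    by (induction N) auto
  have "summable (\<lambda>k. 1 / real (a (Suc k)))"
  proof (rule ccontr)
    assume "\<not> summable (\<lambda>k. 1 / real (a (Suc k)))"
    then have "filterlim (\<lambda>N. \<Sum>k<N. 1 / real (a (Suc k))) at_top sequentially"
      by (rule nonneg_partial_sums_at_top[rotated]) simp
    then show False using not unfolding shift by blast
  qed
  then obtain N where N: "\<And>m n. N \<le> m \<Longrightarrow> norm (\<Sum>k\<in>{m..<n}. 1 / real (a (Suc k))) < 1 / 4"
    unfolding summable_Cauchy using zero_less_divide_1_iff[of "4::real"] by (metis zero_less_numeral)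
  have "\<beta> N / 4 \<le> measure lebesgue (middle_cover N m)" for m
  proof (rule measure_middle_cover_ge)
    have "(\<Sum>k\<le>m. 1 / real (a (Suc (N + k)))) = (\<Sum>k\<in>{N..<N + Suc m}. 1 / real (a (Suc k)))"
      by (rule sum.reindex_bij_witness[of _ "\<lambda>k. k - N" "\<lambda>k. N + k"]) auto
    also have "\<dots> \<le> 1 / 4" using N[of N "N + Suc m"] unfolding real_norm_def by linarith
    finally show "(\<Sum>k\<le>m. 1 / real (a (Suc (N + k)))) \<le> 1 / 4" .
  qed
  moreover have "(\<lambda>m. measure lebesgue (middle_cover N m)) \<longlonglongrightarrow> 0"
  proof -
    have "(\<Inter>m. middle_cover N m) \<subseteq> {t \<in> {0<..<\<beta> 0}. uniquely_expands 0 t}"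
    proof
      fix t assume "t \<in> (\<Inter>m. middle_cover N m)"
      then have m: "\<And>m. t \<in> middle_cover N m" by blast
      then have "\<beta> (Suc N) < t" "t < \<beta> N" using m[of 0] by auto
      moreover have "uniquely_expands N t" using m by (rule middle_core_uniquely_expands)
      ultimately show "t \<in> {t \<in> {0<..<\<beta> 0}. uniquely_expands 0 t}"
        using uniquely_expands_iff_0[of t N] rem_pos[of "Suc N"] rem_antimono[of 0 N] by auto
    qed
    then show ?thesis
      using assms middle_core_negligible_iff[of N]
      by (meson negligible_iff_null_sets negligible_subset)
  qed
  ultimately have "\<beta> N / 4 \<le> 0" by (intro LIMSEQ_le_const) auto
  then show False using rem_pos[of N] by simp
qed

end

section \<open>The measure of the set of uniquely expandable numbers\<close>

text \<open>
  Digit sequences indexed from \<open>1\<close> with an irrelevant fixed value at \<open>0\<close> correspond to plain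
  sequences indexed from \<open>0\<close>, by shifting the index.
\<close>

lemma unique_digit_seq_iff:
  fixes w :: "nat \<Rightarrow> real"
  shows "(\<exists>!x. x \<in> digit_seqs a \<and> (\<lambda>n. real (x (Suc n)) * w n) sums t) \<longleftrightarrow>
    (\<exists>!d. (\<forall>k. d k \<le> a (Suc k)) \<and> (\<lambda>k. real (d k) * w k) sums t)" (is "?L \<longleftrightarrow> ?R")
proof -
  have mem: "case_nat undefined d \<in> digit_seqs a \<longleftrightarrow> (\<forall>k. d k \<le> a (Suc k))" for d
    unfolding digit_seqs_def PiE_iff extensional_def by (auto simp: Suc_le_eq gr0_conv_Suc split: nat.split)
  have eta: "x = case_nat undefined (\<lambda>k. x (Suc k))" if "x \<in> digit_seqs a" for x
    using that unfolding digit_seqs_def PiE_iff extensional_def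
    by (auto simp: fun_eq_iff split: nat.split)
  define E where "E d \<longleftrightarrow> (\<forall>k. d k \<le> a (Suc k)) \<and> (\<lambda>k. real (d k) * w k) sums t" for d
  define F where "F x \<longleftrightarrow> x \<in> digit_seqs a \<and> (\<lambda>n. real (x (Suc n)) * w n) sums t" for x
  have FE: "F (case_nat undefined d) \<longleftrightarrow> E d" for d by (simp add: F_def E_def mem)
  have etaF: "x = case_nat undefined (\<lambda>k. x (Suc k))" if "F x" for x
    using that eta by (simp add: F_def)
  have inj: "d = e" if "case_nat (undefined::nat) d = case_nat undefined e" for d e :: "nat \<Rightarrow> nat"
    using that by (metis nat.case(2) ext)
  have "(\<exists>!x. F x) \<longleftrightarrow> (\<exists>!d. E d)" using FE etaF inj by metis
  then show ?thesis by (simp only: E_def F_def)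
qed

theorem theorem3p14:
  fixes \<alpha> :: real and a :: "nat \<Rightarrow> nat"
  assumes "0 < \<alpha>" and "\<alpha> < 1" and "\<alpha> \<notin> \<rat>"
    and "regular_cf_expansion \<alpha> a"
  shows "unique_expansion_set \<alpha> a \<in> null_sets lebesgue \<longleftrightarrow>
    filterlim (\<lambda>N. \<Sum>n=1..N. 1 / real (a n)) at_top sequentially"
proof -
  obtain \<tau> where \<tau>: "\<tau> 1 = \<alpha>" "\<And>n. n \<ge> 1 \<Longrightarrow> 0 < \<tau> n"
    "\<And>n. n \<ge> 1 \<Longrightarrow> \<tau> (Suc n) = 1 / \<tau> n - real (a n)"
    using complete_quotients_exist[OF assms(3,4)] by auto
  define \<beta> where "\<beta> n = (\<Prod>k=1..n. \<tau> k)" for n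
  interpret cf_remainders a \<beta>
  proof
    fix n
    show "a (Suc n) \<ge> 1" using assms(4) by (simp add: regular_cf_expansion_def)
    show "\<beta> n > 0" unfolding \<beta>_def using \<tau>(2) by (intro prod_pos) auto
    show "\<beta> n = real (a (Suc n)) * \<beta> (Suc n) + \<beta> (Suc (Suc n))"
    proof -
      have "\<tau> (Suc n) * (real (a (Suc n)) + \<tau> (Suc (Suc n))) = 1"
        using \<tau>(2)[of "Suc n"] \<tau>(3)[of "Suc n"] by (simp add: field_simps)
      then have "\<beta> n * (\<tau> (Suc n) * (real (a (Suc n)) + \<tau> (Suc (Suc n)))) = \<beta> n" by simp
      then show ?thesis by (simp add: \<beta>_def algebra_simps)
    qed
  qed
  have dist: "cf_dist \<alpha> a (Suc n) = \<beta> (Suc n)" for n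
    unfolding \<beta>_def by (rule cf_dist_as_product[OF \<tau>])
  have "unique_expansion_set \<alpha> a = {t \<in> {0<..<\<beta> 0}. uniquely_expands 0 t}"
    unfolding unique_expansion_set_def dist unique_digit_seq_iff expands_def by (simp add: \<beta>_def)
  then show ?thesis
    using uniquely_expands_null_if_divergent divergent_if_uniquely_expands_null by auto
qed

end
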